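(* Let $k\in\mathcal{C}$ be a circle with center $c\in\mathcal{P}$ and let $\mathcal{K}=\{c\}$ (the one-letter word $c$). There exists a countable set $Y\subset k$ that is dense in $k$ and such that for every finite tuple of points $p_i\in Y$, $i=1,2,\dots,n$, in every straightedge deterministic (not necessarily terminating) $\mathrm{EC}(\emptyset)$ $T=(r,V,E)$ with root $r=kp_1p_2\dots p_n$, for every vertex $u\in V$ the point $c$ is not a letter of $u$. Thus no straightedge deterministic $\mathrm{EC}(\emptyset)$ constructs $\mathcal{K}$ (the center $c$ of $k$) from $r$ (the given circle $k$ plus some $n$ points from $Y$ on it).
   Context: For a set (alphabet) $A$, $A^*$ is the set of finite words over $A$. A rooted tree $T=(r,V,E)$ consists of a vertex set $V$, a root $r\in V$ and edges $E\subset V\times V$ such that for every $u\in V$ there is a unique walk from $r$ to $u$; if $(u,v)\in E$ then $v$ is a child of $u$; a leaf is a vertex with no child; a branch is a maximal (finite or infinite) walk. $\mathcal{P}=\mathbb{R}^2$ is the set of points, $\mathcal{L}$ the set of lines in $\mathbb{R}^2$, $\mathcal{C}$ the set of circles of positive radius in $\mathbb{R}^2$; elements of $\mathcal{L}\cup\mathcal{C}$ are called curves. For points $a\ne b$, $l(a,b)$ is the line through $a,b$. For points $a$ and $b\neq c$, $k(a,b,c)$ is the circle with center $a$ and radius $|bc|$; moreover $k(a,b,b)=a\in\mathcal{P}$. A set $Y\subset k$ is dense in the circle $k$ if $Y\cap D\ne\emptyset$ for every open disc $D$ of positive radius intersecting $k$. A deterministic Euclidean construction, denoted $\mathrm{EC}(\emptyset)$,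 is a rooted tree $T=(r,V,E)$ with $V\subset(\mathcal{P}\cup\mathcal{L}\cup\mathcal{C})^*$ in which the children of each vertex $u=a_1a_2\dots a_m$, $m\ge0$, are determined by exactly one of the following rules (so $T$ consists of a single branch). 1. $u$ is a leaf. 2. $u$ has exactly one child $a_1\dots a_ma_{m+1}$, where $a_{m+1}=l(a_i,a_j)$ for some $1\le i<j\le m$ with $a_i,a_j\in\mathcal{P}$, $a_i\ne a_j$. 3. $u$ has exactly one child $a_1\dots a_ma_{m+1}$, where $a_{m+1}=k(a_i,a_j,a_k)$ for some $1\le i,j,k\le m$ with $a_i,a_j,a_k\in\mathcal{P}$. 4. $u$ has exactly one child $a_1\dots a_ma_{m+1}$, where $a_{m+1}\in\mathcal{P}$ is an intersection point of two curves $a_i\ne a_j$, $1\le i<j\le m$. $T$ is a straightedge construction if no edge is obtained by rule 3 with $a_j\ne a_k$. $T$ is terminating if all its branches are finite. For $\mathcal{K}\subset(\mathcal{P}\cup\mathcal{L}\cup\mathcal{C})^*$, an $\mathrm{EC}(\emptyset)$ of a certain type constructs $\mathcal{K}$ from $r$ if there is a terminating $\mathrm{EC}(\emptyset)$ $T=(r,V,E)$ of that type with root $r$ such that every leaf $a_1\dots a_m$ of $T$ has a final segment $a_ja_{j+1}\dots a_m\in\mathcal{K}$. *)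

theory Defs
  imports "HOL-Analysis.Analysis" "HOL-Library.Sublist"
begin

type_synonym point = "real ^ 2"

definition lines :: "point set set" where
  "lines = {affine hull {a, b} | a b. a \<noteq> b}"

definition circles :: "point set set" where
  "circles = {sphere a \<rho> | a \<rho>. 0 < \<rho>}"

text \<open>A letter is a point, or a line or circle given as the set of its points.  The type admits
  arbitrary sets below Curve; \<open>alphabet\<close> cuts it down to points, lines and circles.\<close>

datatype letter = Pt point | Curve "point set"

type_synonym word = "letter list"

definition alphabet :: "letter set" where
  "alphabet = range Pt \<union> Curve ` (lines \<union> circles)"

definition line_through :: "point \<Rightarrow> point \<Rightarrow> letter" where
  "line_through a b = Curve (affine hull {a, b})"

definition compass :: "point \<Rightarrow> point \<Rightarrow> point \<Rightarrow> letter" where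
  "compass a b c = (if b = c then Pt a else Curve (sphere a (dist b c)))"

definition dense_in_circle :: "point set \<Rightarrow> point set \<Rightarrow> bool" where
  "dense_in_circle Y k \<longleftrightarrow>
     Y \<subseteq> k \<and> (\<forall>x e. 0 < e \<longrightarrow> ball x e \<inter> k \<noteq> {} \<longrightarrow> Y \<inter> ball x e \<noteq> {})"

definition walk :: "('v \<times> 'v) set \<Rightarrow> 'v \<Rightarrow> 'v list \<Rightarrow> 'v \<Rightarrow> bool" where
  "walk E u ws v \<longleftrightarrow>
     ws \<noteq> [] \<and> hd ws = u \<and> last ws = v \<and> successively (\<lambda>x y. (x, y) \<in> E) ws"

definition rooted_tree :: "'v \<Rightarrow> 'v set \<Rightarrow> ('v \<times> 'v) set \<Rightarrow> bool" where
  "rooted_tree r V E \<longleftrightarrow> r \<in> V \<and> E \<subseteq> V \<times> V \<and> (\<forall>u\<in>V. \<exists>!ws. walk E r ws u)"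

definition children :: "('v \<times> 'v) set \<Rightarrow> 'v \<Rightarrow> 'v set" where
  "children E u = {v. (u, v) \<in> E}"

definition leaf :: "'v set \<Rightarrow> ('v \<times> 'v) set \<Rightarrow> 'v \<Rightarrow> bool" where
  "leaf V E u \<longleftrightarrow> u \<in> V \<and> children E u = {}"

text \<open>A branch is a maximal walk.  An infinite walk can only be prolonged at its start, so it is
  maximal iff its first vertex has no predecessor.\<close>

definition infinite_branch :: "('v \<times> 'v) set \<Rightarrow> (nat \<Rightarrow> 'v) \<Rightarrow> bool" where
  "infinite_branch E f \<longleftrightarrow> (\<forall>i. (f i, f (Suc i)) \<in> E) \<and> (\<nexists>w. (w, f 0) \<in> E)"

definition terminating :: "('v \<times> 'v) set \<Rightarrow> bool" where
  "terminating E \<longleftrightarrow> (\<nexists>f. infinite_branch E f)"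

text \<open>In the rules below, \<open>u\<close> is the current word and \<open>x\<close> the letter appended to it.\<close>

definition line_rule :: "word \<Rightarrow> letter \<Rightarrow> bool" where
  "line_rule u x \<longleftrightarrow>
     (\<exists>i j a b. i < j \<and> j < length u \<and> u ! i = Pt a \<and> u ! j = Pt b \<and> a \<noteq> b \<and>
        x = line_through a b)"

definition compass_rule :: "word \<Rightarrow> letter \<Rightarrow> bool" where
  "compass_rule u x \<longleftrightarrow>
     (\<exists>i j l a b c. i < length u \<and> j < length u \<and> l < length u \<and>
        u ! i = Pt a \<and> u ! j = Pt b \<and> u ! l = Pt c \<and> x = compass a b c)"

definition intersection_rule :: "word \<Rightarrow> letter \<Rightarrow> bool" where
  "intersection_rule u x \<longleftrightarrow>
     (\<exists>i j A B p. i < j \<and> j < length u \<and> u ! i = Curve A \<and> u ! j = Curve B \<and> A \<noteq> B \<and>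
        p \<in> A \<inter> B \<and> x = Pt p)"

text \<open>Only the set of children matters, not which rule is used to justify it: the same new point
  may be obtainable both by \<open>compass_rule\<close> (as \<open>compass a b b\<close>) and by \<open>intersection_rule\<close>.\<close>

definition det_EC :: "word \<Rightarrow> word set \<Rightarrow> (word \<times> word) set \<Rightarrow> bool" where
  "det_EC r V E \<longleftrightarrow> rooted_tree r V E \<and> V \<subseteq> lists alphabet \<and>
     (\<forall>u\<in>V. leaf V E u \<or>
        (\<exists>x. children E u = {u @ [x]} \<and>
           (line_rule u x \<or> compass_rule u x \<or> intersection_rule u x)))"

definition straightedge :: "(word \<times> word) set \<Rightarrow> bool" where
  "straightedge E \<longleftrightarrow>
     \<not> (\<exists>u v i j l a b c. (u, v) \<in> E \<and> i < length u \<and> j < length u \<and> l < length u \<and>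
          u ! i = Pt a \<and> u ! j = Pt b \<and> u ! l = Pt c \<and> b \<noteq> c \<and> v = u @ [compass a b c])"

definition straightedge_det_EC :: "word \<Rightarrow> word set \<Rightarrow> (word \<times> word) set \<Rightarrow> bool" where
  "straightedge_det_EC r V E \<longleftrightarrow> det_EC r V E \<and> straightedge E"

text \<open>The argument \<open>typ\<close> is the type of construction, a predicate on trees \<open>(r, V, E)\<close>.\<close>

definition constructs ::
  "(word \<Rightarrow> word set \<Rightarrow> (word \<times> word) set \<Rightarrow> bool) \<Rightarrow> word set \<Rightarrow> word \<Rightarrow> bool" where
  "constructs typ K r \<longleftrightarrow>
     (\<exists>V E. typ r V E \<and> terminating E \<and>
        (\<forall>u. leaf V E u \<longrightarrow> (\<exists>w\<in>K. w \<noteq> [] \<and> suffix w u)))"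

end

theory Submission
  imports Defs
begin

text \<open>Let \<open>F\<close> be a countable subfield of the reals that is closed under square roots and
  contains the coordinates of a countable dense subset of the unit circle.  Straightedge
  constructions from these points never leave the points and lines of the projective plane over
  \<open>F\<close>.  For \<open>t \<notin> F\<close> with \<open>\<bar>t\<bar> < 1\<close>, some projective map preserves the circle and takes
  \<open>(t, 0)\<close> to the center.  The image \<open>Y\<close> of the dense set is again dense; by projective
  invariance, the center being constructible from \<open>Y\<close> would put \<open>(t, 0)\<close> in the plane over
  \<open>F\<close>.\<close>

section \<open>Countable fields closed under square roots\<close>

text \<open>Formal expressions in countably many generators. There are only countably many of them,
  so the set of their values is countable as well.\<close>

datatype surd = Gen nat | Add surd surd | Neg surd | Mul surd surd | Inv surd | Root surd

instance surd :: countable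
  by countable_datatype

primrec surd_val :: "(nat \<Rightarrow> real) \<Rightarrow> surd \<Rightarrow> real" where
  "surd_val g (Gen n) = g n"
| "surd_val g (Add a b) = surd_val g a + surd_val g b"
| "surd_val g (Neg a) = - surd_val g a"
| "surd_val g (Mul a b) = surd_val g a * surd_val g b"
| "surd_val g (Inv a) = inverse (surd_val g a)"
| "surd_val g (Root a) = sqrt (surd_val g a)"

text \<open>The last two closure conditions carry no side condition: \<open>inverse 0 = 0\<close>
  and \<open>sqrt\<close> is an odd function on the reals, so these values stay in \<open>F\<close>
  too.\<close>

locale sqrt_field =
  fixes F :: "real set"
  assumes one_closed: "1 \<in> F"
    and add_closed: "a \<in> F \<Longrightarrow> b \<in> F \<Longrightarrow> a + b \<in> F"
    and neg_closed: "a \<in> F \<Longrightarrow> - a \<in> F"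
    and mult_closed: "a \<in> F \<Longrightarrow> b \<in> F \<Longrightarrow> a * b \<in> F"
    and inverse_closed: "a \<in> F \<Longrightarrow> inverse a \<in> F"
    and sqrt_closed: "a \<in> F \<Longrightarrow> sqrt a \<in> F"
begin

lemma diff_closed: "a \<in> F \<Longrightarrow> b \<in> F \<Longrightarrow> a - b \<in> F"
  using add_closed[of a "- b"] neg_closed by simp

lemma divide_closed: "a \<in> F \<Longrightarrow> b \<in> F \<Longrightarrow> a / b \<in> F"
  by (simp add: divide_inverse mult_closed inverse_closed)

text \<open>Cross products give the join of two points and the meet of two lines in the projective
  plane; their entries are polynomials in the given coordinates.\<close>

lemma cross3_closed:
  assumes "\<forall>i. v $ i \<in> F" "\<forall>i. w $ i \<in> F"
  shows "\<forall>i. cross3 v w $ i \<in> F"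
  using assms by (simp add: cross3_def forall_3 diff_closed mult_closed)

text \<open>The vector (x, y) is recovered linearly from its inner product -\<gamma> with (\<alpha>,
  \<beta>) and from the determinant \<open>w\<close>. The Lagrange identity makes \<open>w\<close> a
  square root of an element of \<open>F\<close>, up to sign.\<close>

lemma unit_circle_line_closed:
  assumes "\<alpha> \<in> F" "\<beta> \<in> F" "\<gamma> \<in> F" and nz: "\<alpha> \<noteq> 0 \<or> \<beta> \<noteq> 0 \<or> \<gamma> \<noteq> 0"
    and line: "\<alpha> * x + \<beta> * y + \<gamma> = 0" and circle: "x\<^sup>2 + y\<^sup>2 = 1"
  shows "x \<in> F \<and> y \<in> F"
proof -
  define n where "n = \<alpha> * \<alpha> + \<beta> * \<beta>"
  define w where "w = \<beta> * x - \<alpha> * y"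
  \<comment> \<open>If \<alpha> and \<beta> vanish, then \<open>line\<close> forces \<gamma> to
    vanish as well, against \<open>nz\<close>.\<close>
  have "n \<noteq> 0"
    using nz line by (auto simp: n_def sum_squares_eq_zero_iff)
  have "\<gamma> = - (\<alpha> * x + \<beta> * y)"
    using line by linarith
  have "w\<^sup>2 + \<gamma>\<^sup>2 = n * (x\<^sup>2 + y\<^sup>2)"
    unfolding \<open>\<gamma> = _\<close> w_def n_def by (simp add: power2_eq_square algebra_simps)
  then have "w\<^sup>2 = n - \<gamma> * \<gamma>"
    using circle by (simp add: power2_eq_square)
  then have "\<bar>w\<bar> = sqrt (n - \<gamma> * \<gamma>)"
    by (metis real_sqrt_abs)
  then have "\<bar>w\<bar> \<in> F"
    using assms by (simp add: n_def sqrt_closed diff_closed add_closed mult_closed)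
  then have "w \<in> F"
    using neg_closed[of "\<bar>w\<bar>"] by (auto simp: abs_if split: if_splits)
  have "x * n = \<beta> * w - \<alpha> * \<gamma>" "y * n = - (\<alpha> * w + \<beta> * \<gamma>)"
    unfolding \<open>\<gamma> = _\<close> w_def n_def by (simp_all add: algebra_simps)
  then have "x = (\<beta> * w - \<alpha> * \<gamma>) / n" "y = - (\<alpha> * w + \<beta> * \<gamma>) / n"
    using \<open>n \<noteq> 0\<close> by (simp_all add: nonzero_eq_divide_eq)
  then show ?thesis
    using assms \<open>w \<in> F\<close>
    by (simp add: n_def divide_closed diff_closed add_closed mult_closed neg_closed)
qed

end

lemma countable_sqrt_field_exists:
  fixes C :: "real set"
  assumes "countable C"
  obtains F where "sqrt_field F" "countable F" "C \<subseteq> F"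
proof
  \<comment> \<open>Inserting 1 makes the enumerated set nonempty, as a surjective enumeration
    requires, and puts 1 into \<open>F\<close>.\<close>
  define g where "g = from_nat_into (insert 1 C)"
  define F where "F = range (surd_val g)"
  have g: "range g = insert 1 C"
    unfolding g_def using assms by (intro range_from_nat_into) auto
  have gen: "insert 1 C \<subseteq> F"
    unfolding F_def g[symmetric] by (metis image_subsetI rangeI surd_val.simps(1))
  show "sqrt_field F"
  proof
    show "1 \<in> F" using gen by simp
    fix a b assume "a \<in> F"
    then obtain e where e: "a = surd_val g e" unfolding F_def by auto
    show "- a \<in> F" "inverse a \<in> F" "sqrt a \<in> F"
      unfolding F_def e by (metis rangeI surd_val.simps)+
    assume "b \<in> F"
    then obtain e' where e': "b = surd_val g e'" unfolding F_def by auto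
    show "a + b \<in> F" "a * b \<in> F"
      unfolding F_def e e' by (metis rangeI surd_val.simps)+
  qed
  show "countable F" unfolding F_def by simp
  show "C \<subseteq> F" using gen by simp
qed

section \<open>Coordinates in which the given circle is the unit circle\<close>

locale moved_circle = sqrt_field F for F +
  fixes c :: point and \<rho> t :: real
  assumes radius_pos: "0 < \<rho>" and t_gt: "-1 < t" and t_less: "t < 1"
begin

text \<open>In homogeneous coordinates the projective map is, up to scaling, the Lorentz boost with
  velocity \<open>t\<close>; \<open>s\<close> is the reciprocal of its Lorentz factor.\<close>

definition s :: real where "s = sqrt (1 - t\<^sup>2)"

lemma s_squared: "s * s = 1 - t * t" and s_pos: "0 < s" and t_squared: "0 < 1 - t * t"
proof -
  have "t\<^sup>2 < 1"
    using t_gt t_less by (simp add: abs_square_less_1)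
  then show "s * s = 1 - t * t" "0 < s" "0 < 1 - t * t"
    by (simp_all add: s_def power2_eq_square)
qed

definition cx :: "point \<Rightarrow> real" where "cx p = (p $ 1 - c $ 1) / \<rho>"
definition cy :: "point \<Rightarrow> real" where "cy p = (p $ 2 - c $ 2) / \<rho>"
definition mk :: "real \<Rightarrow> real \<Rightarrow> point" where "mk x y = c + \<rho> *\<^sub>R vector [x, y]"

lemma cx_mk [simp]: "cx (mk x y) = x" and cy_mk [simp]: "cy (mk x y) = y"
  using radius_pos by (simp_all add: cx_def cy_def mk_def)

lemma mk_coords [simp]: "mk (cx p) (cy p) = p"
  using radius_pos by (simp add: vec_eq_iff forall_2 cx_def cy_def mk_def)

lemma coords_eqI: "cx p = cx q \<Longrightarrow> cy p = cy q \<Longrightarrow> p = q"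
  by (metis mk_coords)

lemma mem_sphere_coords: "p \<in> sphere c \<rho> \<longleftrightarrow> (cx p)\<^sup>2 + (cy p)\<^sup>2 = 1"
proof -
  have "p \<in> sphere c \<rho> \<longleftrightarrow> (dist p c)\<^sup>2 = \<rho>\<^sup>2"
    using radius_pos by (simp add: dist_commute power2_eq_iff_nonneg)
  also have "(dist p c)\<^sup>2 = (p $ 1 - c $ 1)\<^sup>2 + (p $ 2 - c $ 2)\<^sup>2"
    unfolding dist_norm power2_norm_eq_inner by (simp add: inner_vec_def sum_2 power2_eq_square)
  finally show ?thesis
    using radius_pos by (auto simp: cx_def cy_def power_divide add_divide_distrib[symmetric])
qed

lemma coords_affine:
  "cx (a + u *\<^sub>R (b - a)) = cx a + u * (cx b - cx a)"
  "cy (a + u *\<^sub>R (b - a)) = cy a + u * (cy b - cy a)"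
  using radius_pos by (simp_all add: cx_def cy_def field_simps)

lemma affine_hull_coords:
  assumes "a \<noteq> b"
  shows "p \<in> affine hull {a, b} \<longleftrightarrow>
    (cx b - cx a) * (cy p - cy a) = (cy b - cy a) * (cx p - cx a)"
proof
  assume "p \<in> affine hull {a, b}"
  then obtain u where "p = a + u *\<^sub>R (b - a)"
    unfolding affine_hull_2_alt by auto
  then have "cx p - cx a = u * (cx b - cx a)" "cy p - cy a = u * (cy b - cy a)"
    by (simp_all add: coords_affine)
  then show "(cx b - cx a) * (cy p - cy a) = (cy b - cy a) * (cx p - cx a)"
    by simp
next
  assume eq: "(cx b - cx a) * (cy p - cy a) = (cy b - cy a) * (cx p - cx a)"
  \<comment> \<open>The parameter is a ratio of coordinate differences, taken in a coordinate where
    \<open>a\<close> and \<open>b\<close> differ.\<close>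
  have "\<exists>u. cx p = cx a + u * (cx b - cx a) \<and> cy p = cy a + u * (cy b - cy a)"
  proof (cases "cx b = cx a")
    case True
    then have "cy b \<noteq> cy a" using assms coords_eqI by metis
    then show ?thesis using eq True
      by (intro exI[of _ "(cy p - cy a) / (cy b - cy a)"]) auto
  next
    case False
    then show ?thesis using eq
      by (intro exI[of _ "(cx p - cx a) / (cx b - cx a)"]) (auto simp: field_simps)
  qed
  then obtain u where "cx p = cx a + u * (cx b - cx a)" "cy p = cy a + u * (cy b - cy a)"
    by blast
  then have "p = a + u *\<^sub>R (b - a)"
    by (intro coords_eqI) (simp_all add: coords_affine)
  then show "p \<in> affine hull {a, b}"
    unfolding affine_hull_2_alt by auto
qed

section \<open>The projective map in homogeneous coordinates\<close>

text \<open>Homogeneous coordinates of the preimage of a point under the projective map of the proof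
  idea; the preimage may be at infinity.\<close>

definition homog :: "point \<Rightarrow> real ^ 3" where
  "homog p = vector [cx p + t, s * cy p, 1 + t * cx p]"

text \<open>\<open>homog\<close> is a linear map of determinant \<open>s * (1 - t * t)\<close>
  applied to (x, y, 1). The other factor vanishes exactly on collinear triples, so
  \<open>homog\<close> preserves and reflects collinearity.\<close>

lemma det_homog:
  "cross3 (homog a) (homog b) \<bullet> homog p =
    s * (1 - t * t) * ((cx b - cx a) * (cy p - cy a) - (cy b - cy a) * (cx p - cx a))"
  by (simp add: homog_def cross3_def inner_vec_def sum_3 algebra_simps)

text \<open>The linear map behind \<open>homog\<close> multiplies the form
  \<open>x\<^sup>2 + y\<^sup>2 - z\<^sup>2\<close> by \<open>1 - t * t\<close>, hence preserves its
  null cone, the cone over the unit circle.\<close>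

lemma homog_light_cone: "(homog p $ 1)\<^sup>2 + (homog p $ 2)\<^sup>2 = (homog p $ 3)\<^sup>2"
  if "p \<in> sphere c \<rho>"
proof -
  have "(homog p $ 1)\<^sup>2 + (homog p $ 2)\<^sup>2 =
      (cx p)\<^sup>2 + 2 * t * cx p + t\<^sup>2 + (s * s) * (cy p)\<^sup>2"
    by (simp add: homog_def power2_eq_square algebra_simps)
  also have "\<dots> = (homog p $ 3)\<^sup>2 - (1 - t * t) * (1 - ((cx p)\<^sup>2 + (cy p)\<^sup>2))"
    unfolding s_squared by (simp add: homog_def power2_eq_square algebra_simps)
  finally show ?thesis
    using that[unfolded mem_sphere_coords] by simp
qed

text \<open>On the circle neither the map nor its inverse reaches infinity, as
  \<open>t * cx p\<close> has absolute value below 1.\<close>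

lemma denominator_pos: "0 < 1 + t * cx p" "0 < 1 - t * cx p" if "p \<in> sphere c \<rho>"
proof -
  have "(cx p)\<^sup>2 \<le> 1"
    using that[unfolded mem_sphere_coords] by (metis le_add_same_cancel1 zero_le_power2)
  then have "\<bar>cx p\<bar> \<le> 1" by (simp add: abs_square_le_1)
  moreover have "\<bar>t\<bar> < 1" using t_gt t_less by simp
  ultimately have "\<bar>t * cx p\<bar> < 1"
    unfolding abs_mult by (metis abs_ge_zero mult_left_le order_le_less_trans)
  then show "0 < 1 + t * cx p" "0 < 1 - t * cx p" by linarith+
qed

section \<open>Points and lines over \<open>F\<close> and the construction rules\<close>

text \<open>Homogeneous coordinates count only up to a factor, so \<open>l\<close> may be any real;
  only \<open>v\<close> is confined to \<open>F\<close>.\<close>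

definition good_point :: "point \<Rightarrow> bool" where
  "good_point p \<longleftrightarrow> (\<exists>l v. (\<forall>i. v $ i \<in> F) \<and> homog p = l *\<^sub>R v)"

definition good_line :: "point set \<Rightarrow> bool" where
  "good_line A \<longleftrightarrow> (\<exists>w. (\<forall>i. w $ i \<in> F) \<and> w \<noteq> 0 \<and> A = {p. w \<bullet> homog p = 0})"

fun good_letter :: "letter \<Rightarrow> bool" where
  "good_letter (Pt p) = good_point p"
| "good_letter (Curve A) = (A = sphere c \<rho> \<or> good_line A)"

text \<open>The join is the cross product of representatives over \<open>F\<close>; the real factors
  \<open>l\<close> and \<open>m\<close> drop out of the equation of the line.\<close>

lemma good_line_through:
  assumes "good_point a" "good_point b" "a \<noteq> b"
  shows "good_line (affine hull {a, b})"
proof -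
  obtain l v m w where v: "\<forall>i. v $ i \<in> F" "homog a = l *\<^sub>R v"
    and w: "\<forall>i. w $ i \<in> F" "homog b = m *\<^sub>R w"
    using assms unfolding good_point_def by blast
  have det: "cross3 (homog a) (homog b) \<bullet> homog p = 0 \<longleftrightarrow> p \<in> affine hull {a, b}" for p
    using s_pos t_squared by (simp add: det_homog affine_hull_coords[OF assms(3)])
  have scale: "cross3 (homog a) (homog b) = (l * m) *\<^sub>R cross3 v w"
    by (simp add: v w cross_mult_left cross_mult_right)
  \<comment> \<open>A zero cross product would put every point on the line through \<open>a\<close>
    and \<open>b\<close>, contradicting its dimension.\<close>
  have ne: "cross3 (homog a) (homog b) \<noteq> 0"
  proof
    assume "cross3 (homog a) (homog b) = 0"
    then have all: "affine hull {a, b} = UNIV"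
      using det by auto
    have "aff_dim {a, b} = 1" using assms(3) by (simp add: aff_dim_2)
    moreover have "aff_dim {a, b} = 2"
      using all aff_dim_affine_hull[of "{a, b}"] by simp
    ultimately show False by simp
  qed
  then have "l * m \<noteq> 0" "cross3 v w \<noteq> 0" unfolding scale by auto
  moreover have "affine hull {a, b} = {p. cross3 v w \<bullet> homog p = 0}"
    using det \<open>l * m \<noteq> 0\<close> unfolding scale by auto
  ultimately show ?thesis
    unfolding good_line_def using cross3_closed[OF v(1) w(1)] by blast
qed

text \<open>Dually to the join, \<open>homog p\<close> is orthogonal to both coefficient vectors and
  thus a multiple of their cross product. That product is nonzero because proportional vectors
  define the same line.\<close>

lemma good_point_lines:
  assumes "good_line A" "good_line B" "A \<noteq> B" "p \<in> A" "p \<in> B"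
  shows "good_point p"
proof -
  obtain v w where v: "\<forall>i. v $ i \<in> F" "v \<noteq> 0" "A = {p. v \<bullet> homog p = 0}"
    and w: "\<forall>i. w $ i \<in> F" "w \<noteq> 0" "B = {p. w \<bullet> homog p = 0}"
    using assms unfolding good_line_def by blast
  have ne: "cross3 v w \<noteq> 0"
  proof
    assume "cross3 v w = 0"
    then obtain u where u: "w = u *\<^sub>R v"
      using v(2) w(2) by (auto simp: cross_eq_0 collinear_lemma)
    then have "A = B" unfolding v(3) w(3) using w(2) by auto
    then show False using assms(3) by simp
  qed
  have "cross3 (cross3 v w) (homog p) = 0"
    using assms(4,5) v(3) w(3) by (simp add: cross_skew[of "cross3 v w"] Lagrange inner_commute)
  then obtain u where "homog p = u *\<^sub>R cross3 v w"
    using ne by (auto simp: cross_eq_0 collinear_lemma intro: exI[of _ 0])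
  then show ?thesis
    unfolding good_point_def using cross3_closed[OF v(1) w(1)] by blast
qed

text \<open>Dividing by the third coordinate gives a point (x, y) that lies on the unit circle and
  on a line over \<open>F\<close>, so both coordinates are in \<open>F\<close>.\<close>

lemma good_point_line_circle:
  assumes "good_line A" "p \<in> A" "p \<in> sphere c \<rho>"
  shows "good_point p"
proof -
  obtain w where w: "\<forall>i. w $ i \<in> F" "w \<noteq> 0" "w \<bullet> homog p = 0"
    using assms unfolding good_line_def by blast
  let ?h = "homog p"
  define x where "x = ?h $ 1 / ?h $ 3"
  define y where "y = ?h $ 2 / ?h $ 3"
  have pos: "?h $ 3 \<noteq> 0"
    using denominator_pos(1)[OF assms(3)] by (simp add: homog_def)
  have h: "?h $ 1 = ?h $ 3 * x" "?h $ 2 = ?h $ 3 * y"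
    using pos by (simp_all add: x_def y_def)
  have "?h $ 3 * (w $ 1 * x + w $ 2 * y + w $ 3) = 0"
    using w(3) by (simp add: inner_vec_def sum_3 h algebra_simps)
  then have "w $ 1 * x + w $ 2 * y + w $ 3 = 0"
    using pos by simp
  moreover have "x\<^sup>2 + y\<^sup>2 = 1"
    using homog_light_cone[OF assms(3)] pos
    by (simp add: x_def y_def power_divide add_divide_distrib[symmetric])
  moreover have "w $ 1 \<noteq> 0 \<or> w $ 2 \<noteq> 0 \<or> w $ 3 \<noteq> 0"
    using w(2) by (auto simp: vec_eq_iff forall_3)
  ultimately have "x \<in> F \<and> y \<in> F"
    using w(1) unit_circle_line_closed by blast
  moreover have "?h = ?h $ 3 *\<^sub>R vector [x, y, 1]"
    by (simp add: vec_eq_iff forall_3 h)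
  ultimately show ?thesis
    unfolding good_point_def using one_closed
    by (intro exI[of _ "?h $ 3"] exI[of _ "vector [x, y, 1] :: real ^ 3"]) (simp add: forall_3)
qed

text \<open>\<open>homog c\<close> is (t, 0, 1), and ratios of coordinates do not depend on the
  scaling.\<close>

lemma center_not_good: "\<not> good_point c" if "t \<notin> F"
proof
  assume "good_point c"
  then obtain l v where v: "\<forall>i. v $ i \<in> F" and h: "homog c = l *\<^sub>R v"
    unfolding good_point_def by blast
  have "t = l * v $ 1" "1 = l * v $ 3"
    using h by (simp_all add: vec_eq_iff forall_3 homog_def cx_def cy_def)
  moreover from this have "l \<noteq> 0" "v $ 3 \<noteq> 0" by auto
  ultimately have "t = v $ 1 / v $ 3"
    by (metis nonzero_mult_divide_mult_cancel_left div_by_1)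
  then show False
    using that divide_closed[of "v $ 1" "v $ 3"] v by simp
qed

lemma good_letter_step:
  assumes good: "\<forall>x\<in>set u. good_letter x"
    and st: "straightedge E" and edge: "(u, u @ [x]) \<in> E"
    and rule: "line_rule u x \<or> compass_rule u x \<or> intersection_rule u x"
  shows "good_letter x"
  using rule
proof (elim disjE)
  assume "line_rule u x"
  then obtain a b where "Pt a \<in> set u" "Pt b \<in> set u" "a \<noteq> b" "x = line_through a b"
    unfolding line_rule_def by (metis nth_mem order_less_trans)
  then show ?thesis
    using good good_line_through by (fastforce simp: line_through_def)
next
  assume "compass_rule u x"
  then obtain i j l a b d where *: "i < length u" "j < length u" "l < length u"
    "u ! i = Pt a" "u ! j = Pt b" "u ! l = Pt d" "x = compass a b d"
    unfolding compass_rule_def by blast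
  \<comment> \<open>\<open>compass a b d\<close> with distinct \<open>b\<close> and \<open>d\<close>
    is the step that \<open>straightedge\<close> forbids; with \<open>b = d\<close> it merely
    repeats the point \<open>a\<close>.\<close>
  then have "b = d"
    using st edge unfolding straightedge_def by blast
  then show ?thesis
    using * good by (metis compass_def nth_mem)
next
  assume "intersection_rule u x"
  then obtain A B p where *: "Curve A \<in> set u" "Curve B \<in> set u" "A \<noteq> B" "p \<in> A" "p \<in> B" "x = Pt p"
    unfolding intersection_rule_def by (metis IntE nth_mem order_less_trans)
  \<comment> \<open>Two circles cannot meet here: \<open>A\<close> and \<open>B\<close> differ, so
    at least one of them is a line.\<close>
  then have "good_letter (Curve A)" "good_letter (Curve B)"
    using good by blast+
  then show ?thesis
    using * good_point_lines good_point_line_circle by auto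
qed

section \<open>The action of the map on the circle\<close>

text \<open>The projective inverse of \<^const>\<open>homog\<close>; a junk value where \<open>t * cx q = 1\<close>, a line that
  misses the circle.\<close>

definition move :: "point \<Rightarrow> point" where
  "move q = mk ((cx q - t) / (1 - t * cx q)) (s * cy q / (1 - t * cx q))"

text \<open>The matrices of \<open>move\<close> and \<open>homog\<close> multiply to
  \<open>1 - t * t\<close> times the identity. The remaining factor comes from the denominator in
  \<open>move\<close>.\<close>

lemma homog_move:
  assumes "q \<in> sphere c \<rho>"
  shows "homog (move q) = ((1 - t * t) / (1 - t * cx q)) *\<^sub>R vector [cx q, cy q, 1]"
proof -
  have "1 - t * cx q \<noteq> 0"
    using denominator_pos(2)[OF assms] by simp
  then have "(cx q - t) / (1 - t * cx q) + t = (1 - t * t) / (1 - t * cx q) * cx q"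
    "1 + t * ((cx q - t) / (1 - t * cx q)) = (1 - t * t) / (1 - t * cx q)"
    by (simp_all add: field_simps)
  then show ?thesis
    by (simp add: vec_eq_iff forall_3 homog_def move_def s_squared[symmetric])
qed

lemma good_point_move:
  assumes "q \<in> sphere c \<rho>" "cx q \<in> F" "cy q \<in> F"
  shows "good_point (move q)"
proof -
  have "\<forall>i. (vector [cx q, cy q, 1] :: real ^ 3) $ i \<in> F"
    by (simp add: forall_3 assms one_closed)
  then show ?thesis
    unfolding good_point_def using homog_move[OF assms(1)] by blast
qed

lemma continuous_on_move: "continuous_on (sphere c \<rho>) move"
proof -
  have "1 - t * cx q \<noteq> 0" if "q \<in> sphere c \<rho>" for q
    using denominator_pos(2)[OF that] by simp
  then have cont: "continuous_on (sphere c \<rho>) (\<lambda>q. (cx q - t) / (1 - t * cx q))"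
      "continuous_on (sphere c \<rho>) (\<lambda>q. s * cy q / (1 - t * cx q))"
    unfolding cx_def cy_def using radius_pos by (auto intro!: continuous_intros)
  have mk: "mk x y = c + \<rho> *\<^sub>R (x *\<^sub>R axis 1 1 + y *\<^sub>R axis 2 1)" for x y
    by (simp add: mk_def vec_eq_iff forall_2 axis_def)
  show ?thesis
    unfolding move_def mk by (intro continuous_intros cont)
qed

text \<open>One inclusion is the invariance of the quadratic form again; for the other,
  dehomogenizing \<open>homog p\<close> yields the preimage. Surjectivity is what carries density
  over to the image.\<close>

lemma move_image: "move ` sphere c \<rho> = sphere c \<rho>"
proof (intro equalityI subsetI)
  fix p assume "p \<in> move ` sphere c \<rho>"
  then obtain q where q: "q \<in> sphere c \<rho>" "p = move q"
    by blast
  let ?d = "1 - t * cx q"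
  have "?d \<noteq> 0" using denominator_pos(2)[OF q(1)] by simp
  have "(cx q - t)\<^sup>2 + (s * cy q)\<^sup>2 = (cx q - t)\<^sup>2 + (s * s) * (cy q)\<^sup>2"
    by (simp add: power2_eq_square algebra_simps)
  also have "\<dots> = ?d\<^sup>2 - (1 - t * t) * (1 - ((cx q)\<^sup>2 + (cy q)\<^sup>2))"
    unfolding s_squared by (simp add: power2_eq_square algebra_simps)
  finally have "(cx q - t)\<^sup>2 + (s * cy q)\<^sup>2 = ?d\<^sup>2"
    using q(1)[unfolded mem_sphere_coords] by simp
  then show "p \<in> sphere c \<rho>"
    unfolding mem_sphere_coords using \<open>?d \<noteq> 0\<close>
    by (simp add: q(2) move_def power_divide add_divide_distrib[symmetric])
next
  fix p assume p: "p \<in> sphere c \<rho>"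
  let ?h = "homog p"
  define q where "q = mk (?h $ 1 / ?h $ 3) (?h $ 2 / ?h $ 3)"
  have pos: "?h $ 3 \<noteq> 0"
    using denominator_pos(1)[OF p] by (simp add: homog_def)
  have "q \<in> sphere c \<rho>"
    unfolding mem_sphere_coords using homog_light_cone[OF p] pos
    by (simp add: q_def power_divide add_divide_distrib[symmetric])
  moreover have "move q = p"
  proof -
    have d: "1 - t * cx q = (1 - t * t) / ?h $ 3"
      using pos by (simp add: q_def homog_def field_simps)
    have x: "cx q - t = (1 - t * t) * cx p / ?h $ 3"
      using pos by (simp add: q_def homog_def field_simps)
    have y: "s * cy q = (1 - t * t) * cy p / ?h $ 3"
      by (simp add: q_def homog_def s_squared mult.assoc[symmetric])
    show ?thesis
      unfolding move_def d x y using pos t_squared by simp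
  qed
  ultimately show "p \<in> move ` sphere c \<rho>" by blast
qed

end

section \<open>Density and rooted trees\<close>

lemma dense_in_circleI:
  assumes "Y \<subseteq> k" "k \<subseteq> closure Y"
  shows "dense_in_circle Y k"
  unfolding dense_in_circle_def
proof (intro conjI allI impI)
  fix x :: point and e :: real
  assume "ball x e \<inter> k \<noteq> {}"
  then have "ball x e \<inter> closure Y \<noteq> {}" using assms(2) by blast
  then show "Y \<inter> ball x e \<noteq> {}"
    using open_Int_closure_eq_empty[of "ball x e" Y] by auto
qed (fact assms(1))

lemma walk_extend:
  assumes "walk E u ws v" "(v, w) \<in> E"
  shows "walk E u (ws @ [w]) w"
  using assms by (auto simp: walk_def successively_append_iff)

lemma rooted_tree_induct [consumes 2, case_names root edge]:
  assumes "rooted_tree r V E" "u \<in> V"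
    and root: "P r" and edge: "\<And>v w. (v, w) \<in> E \<Longrightarrow> P v \<Longrightarrow> P w"
  shows "P u"
proof -
  have walk: "P x" if "walk E r ws x" for ws x
    using that
  proof (induction ws arbitrary: x rule: rev_induct)
    case (snoc y ws)
    show ?case
    proof (cases "ws = []")
      case True
      then show ?thesis using snoc.prems root by (auto simp: walk_def)
    next
      case False
      then have "walk E r ws (last ws)" "(last ws, x) \<in> E"
        using snoc.prems by (auto simp: walk_def successively_append_iff)
      then show ?thesis using snoc.IH edge by blast
    qed
  qed (simp add: walk_def)
  then show ?thesis
    using assms(1,2) unfolding rooted_tree_def by blast
qed

text \<open>An edge into the root would close a second walk from the root to itself, besides the
  trivial one.\<close>

lemma root_no_predecessor:
  assumes "rooted_tree r V E"
  shows "(w, r) \<notin> E"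
proof
  assume wr: "(w, r) \<in> E"
  then obtain ws where ws: "walk E r ws w"
    using assms unfolding rooted_tree_def by blast
  have "walk E r (ws @ [r]) r" by (rule walk_extend[OF ws wr])
  moreover have "walk E r [r] r" by (simp add: walk_def)
  ultimately have "ws @ [r] = [r]"
    using assms unfolding rooted_tree_def by blast
  then show False using ws by (simp add: walk_def)
qed

text \<open>Without leaves, children can be chosen forever from the root, and the resulting walk is
  maximal. A leaf is what turns the condition on all leaves in \<open>constructs\<close> into an
  actual occurrence of the center.\<close>

lemma terminating_leaf_exists:
  assumes tree: "rooted_tree r V E" and "terminating E"
  shows "\<exists>u. leaf V E u"
proof (rule ccontr)
  assume no: "\<nexists>u. leaf V E u"
  have rV: "r \<in> V" and EV: "E \<subseteq> V \<times> V" using tree by (auto simp: rooted_tree_def)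
  have "\<exists>v. v \<in> V \<and> (u, v) \<in> E" if "u \<in> V" for u
    using no that EV unfolding leaf_def children_def by blast
  then obtain f where f: "f 0 = r" "\<And>n. (f n, f (Suc n)) \<in> E"
    using dependent_nat_choice[of "\<lambda>n u. u \<in> V \<and> (n = 0 \<longrightarrow> u = r)" "\<lambda>n u v. (u, v) \<in> E"] rV
    by (metis nat.distinct(1))
  then have "infinite_branch E f"
    using root_no_predecessor[OF tree] by (simp add: infinite_branch_def)
  then show False using assms(2) by (auto simp: terminating_def)
qed

section \<open>Constructions from the moved dense set\<close>

lemma (in moved_circle) good_vertex:
  assumes EC: "straightedge_det_EC r V E" and "u \<in> V" and root: "\<forall>x\<in>set r. good_letter x"
  shows "\<forall>x\<in>set u. good_letter x"
proof -
  have tree: "rooted_tree r V E" and st: "straightedge E"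
    and step: "\<And>v. v \<in> V \<Longrightarrow> leaf V E v \<or> (\<exists>x. children E v = {v @ [x]} \<and>
           (line_rule v x \<or> compass_rule v x \<or> intersection_rule v x))"
    using EC unfolding straightedge_det_EC_def det_EC_def by blast+
  from tree \<open>u \<in> V\<close> show ?thesis
  proof (induction rule: rooted_tree_induct)
    case root
    then show ?case by (fact assms(3))
  next
    case (edge v w)
    then have "v \<in> V" "w \<in> children E v"
      using tree by (auto simp: rooted_tree_def children_def)
    then obtain x where "w = v @ [x]"
      and "line_rule v x \<or> compass_rule v x \<or> intersection_rule v x"
      using step[of v] unfolding leaf_def by blast
    then show ?case
      using good_letter_step[OF edge(2) st] edge by auto
  qed
qed

theorem theorem3p2:
  fixes k :: "point set" and c :: point and \<rho> :: real
  assumes "0 < \<rho>" and "k = sphere c \<rho>"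
  shows "\<exists>Y. countable Y \<and> Y \<subseteq> k \<and> dense_in_circle Y k \<and>
    (\<forall>ps. set ps \<subseteq> Y \<longrightarrow>
      (\<forall>V E. straightedge_det_EC (Curve k # map Pt ps) V E \<longrightarrow> (\<forall>u\<in>V. Pt c \<notin> set u)) \<and>
      \<not> constructs straightedge_det_EC {[Pt c]} (Curve k # map Pt ps))"
proof -
  obtain Y\<^sub>0 where Y\<^sub>0: "countable Y\<^sub>0" "Y\<^sub>0 \<subseteq> k" "k \<subseteq> closure Y\<^sub>0"
    using separable[of k] by metis
  \<comment> \<open>These are the values of \<open>cx\<close> and \<open>cy\<close> on
    \<open>Y\<^sub>0\<close>, written out because the locale can be interpreted only after
    \<open>F\<close> and then \<open>t\<close> are chosen.\<close>
  define C where "C = (\<Union>q\<in>Y\<^sub>0. {(q $ 1 - c $ 1) / \<rho>, (q $ 2 - c $ 2) / \<rho>})"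
  have "countable C" unfolding C_def using Y\<^sub>0(1) by auto
  then obtain F where F: "sqrt_field F" "countable F" "C \<subseteq> F"
    by (rule countable_sqrt_field_exists)
  \<comment> \<open>A countable field cannot exhaust an interval, which leaves room for
    \<open>t\<close>.\<close>
  have "\<not> {0 <..< 1 :: real} \<subseteq> F"
    using F(2) countable_subset uncountable_open_interval[of 0 "1::real"] by auto
  then obtain t where "t \<in> {0 <..< 1}" and t_notin: "t \<notin> F" by blast
  then have t: "0 < t" "t < 1" by simp_all
  interpret moved_circle F c \<rho> t
    using F(1) assms(1) t by (simp add: moved_circle_def moved_circle_axioms_def)
  define Y where "Y = move ` Y\<^sub>0"
  have "countable Y" unfolding Y_def using Y\<^sub>0(1) by simp
  have "Y \<subseteq> k" unfolding Y_def using Y\<^sub>0(2) move_image assms(2) by blast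
  \<comment> \<open>Continuity of \<open>move\<close> is known only on the circle, so the closure
    must stay inside it.\<close>
  have "closure Y\<^sub>0 \<subseteq> k"
    using Y\<^sub>0(2) by (intro closure_minimal) (simp_all add: assms(2))
  then have "continuous_on (closure Y\<^sub>0) move"
    using continuous_on_move continuous_on_subset assms(2) by blast
  then have "move ` closure Y\<^sub>0 \<subseteq> closure Y"
    unfolding Y_def by (intro image_closure_subset closed_closure closure_subset)
  then have "k \<subseteq> closure Y"
    using Y\<^sub>0(3) move_image assms(2) by blast
  then have dense: "dense_in_circle Y k"
    by (rule dense_in_circleI[OF \<open>Y \<subseteq> k\<close>])
  have goodY: "good_point p" if "p \<in> Y" for p
  proof -
    from that obtain q where q: "q \<in> Y\<^sub>0" "p = move q" unfolding Y_def by blast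
    then have "cx q \<in> F" "cy q \<in> F"
      using F(3) by (auto simp: C_def cx_def cy_def)
    then show ?thesis using good_point_move q Y\<^sub>0(2) assms(2) by blast
  qed
  have avoid: "Pt c \<notin> set u"
    if ps: "set ps \<subseteq> Y" and EC: "straightedge_det_EC (Curve k # map Pt ps) V E" and "u \<in> V"
    for ps V E u
  proof
    assume "Pt c \<in> set u"
    moreover have "\<forall>x\<in>set (Curve k # map Pt ps). good_letter x"
      using ps goodY assms(2) by auto
    ultimately show False
      using good_vertex[OF EC \<open>u \<in> V\<close>] center_not_good[OF t_notin] by fastforce
  qed
  have "\<not> constructs straightedge_det_EC {[Pt c]} (Curve k # map Pt ps)" if ps: "set ps \<subseteq> Y" for ps
  proof
    assume "constructs straightedge_det_EC {[Pt c]} (Curve k # map Pt ps)"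
    then obtain V E where EC: "straightedge_det_EC (Curve k # map Pt ps) V E" and "terminating E"
      and leaves: "\<And>u. leaf V E u \<Longrightarrow> suffix [Pt c] u"
      unfolding constructs_def by blast
    then obtain u where leaf: "leaf V E u"
      using terminating_leaf_exists[of "Curve k # map Pt ps" V E]
      by (auto simp: straightedge_det_EC_def det_EC_def)
    then have "u \<in> V" by (simp add: leaf_def)
    moreover have "Pt c \<in> set u"
      using leaves[OF leaf] by (auto simp: suffix_def)
    ultimately show False using avoid[OF ps EC] by simp
  qed
  with \<open>countable Y\<close> \<open>Y \<subseteq> k\<close> dense avoid show ?thesis
    by (intro exI[of _ Y] conjI allI impI ballI)
qed

end
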